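(* Let $(G,q_1)$ and $(\Gamma,q_2)$ be metric groups such that $G_2=\{0,g_0\}\cong\mathbb{Z}_2$, $\Gamma_2=\{0,\gamma_0\}\cong\mathbb{Z}_2$, $c:=\mathcal{G}(q_1)=-\mathcal{G}(q_2)$, $\langle g_0,g_0\rangle=-\langle\gamma_0,\gamma_0\rangle$, and $c^2=q_1(g_0)^{-1}q_2(\gamma_0)$. Let $S,T,C$ be the $J\times J$ matrices defined in the context. Then $S$, $T$ and $C$ are unitary matrices satisfying $S^2=C$, $(ST)^3=cC$ and $TC=CT$.
   Context: A metric group $(G,q)$ is a finite abelian group $G$ with a map $q:G\to\mathbb{T}=\{z\in\mathbb{C}:|z|=1\}$ such that $q(-g)=q(g)$ and $\langle g,h\rangle=q(g+h)q(g)^{-1}q(h)^{-1}$ is a non-degenerate bicharacter. $\mathcal{G}(q)=\frac{1}{\sqrt{|G|}}\sum_{g\in G}q(g)$. $G_2=\{g\in G:2g=0\}$. Put $s=c\,\frac{q_1(g_0)^{-1}+q_2(\gamma_0)^{-1}}{\sqrt2}$, $a=1/\sqrt{|G|}$, $b=1/\sqrt{|\Gamma|}$. Fix $G_*\subset G$, $\Gamma_*\subset\Gamma$ with $G=G_2\sqcup G_*\sqcup(-G_* )$, $\Gamma=\Gamma_2\sqcup\Gamma_*\sqcup(-\Gamma_* )$. Let $J_1=\{g_0\}\times\{1,-1\}$, $J_2=\{\gamma_0\}\times\{1,-1\}$, $J=\{0,\pi\}\sqcup J_1\sqcup G_*\sqcup J_2\sqcup\Gamma_*$. Involution on $J$: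 $\overline{(g_0,\varepsilon)}=(g_0,\langle g_0,g_0\rangle\varepsilon)$, $\overline{(\gamma_0,\varepsilon)}=(\gamma_0,\langle g_0,g_0\rangle\varepsilon)$, all other indices fixed. With blocks indexed in order by $\{0\},\{\pi\},J_1,G_*,J_2,\Gamma_*$ (row indices $0,\pi,(g_0,\varepsilon),g,(\gamma_0,\varepsilon),\gamma$; column indices with primes): $$S=\begin{pmatrix} \frac{a-b}{2}&\frac{a+b}{2}&\frac{a}{2}&a&\frac{b}{2}&b\\ \frac{a+b}{2}&\frac{a-b}{2}&\frac{a}{2}&a&-\frac{b}{2}&-b\\ \frac{a}{2}&\frac{a}{2}&(\frac{a}{2}+\frac{\varepsilon\varepsilon's}{2\sqrt{2}})\langle g_0,g_0\rangle&a\langle g_0,g'\rangle&\frac{\varepsilon\varepsilon's}{2\sqrt{2}}&0\\ a&a&a\langle g,g_0\rangle&a(\langle g,g'\rangle+\overline{\langle g,g'\rangle})&0&0\\ \frac{b}{2}&-\frac{b}{2}&\frac{\varepsilon\varepsilon's}{2\sqrt{2}}&0&-(\frac{b}{2}-\frac{\varepsilon\varepsilon's}{2\sqrt{2}})\langle\gamma_0,\gamma_0\rangle&-b\langle\gamma_0,\gamma'\rangle\\ b&-b&0&0&-b\langle\gamma,\gamma_0\rangle&-b(\langle\gamma,\gamma'\rangle+\overline{\langle\gamma,\gamma'\rangle}) \end{pmatrix},$$ $T=\mathrm{Diag}(1,1,q_1(g_0),q_1(g),q_2(\gamma_0),q_2(\gamma))$ (the entries $q_1(g_0)$, $q_2(\gamma_0)$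 being used for both elements of $J_1$, resp. $J_2$), and $C_{j,j'}=\delta_{\overline j,j'}$. *)

theory Defs
  imports "HOL-Analysis.Analysis"
begin

section \<open>Metric groups\<close>

text \<open>Finite abelian groups are types of class \<^class>\<open>ab_group_add\<close> and \<^class>\<open>finite\<close>.\<close>

definition pairing :: "('g::ab_group_add \<Rightarrow> complex) \<Rightarrow> 'g \<Rightarrow> 'g \<Rightarrow> complex"
  where "pairing q g h = q (g + h) * inverse (q g) * inverse (q h)"

definition bicharacter :: "('g::ab_group_add \<Rightarrow> 'g \<Rightarrow> complex) \<Rightarrow> bool"
  where "bicharacter B \<longleftrightarrow>
    (\<forall>g h. norm (B g h) = 1) \<and>
    (\<forall>g g' h. B (g + g') h = B g h * B g' h) \<and>
    (\<forall>g h h'. B g (h + h') = B g h * B g h')"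

text \<open>One-sided non-degeneracy is enough here: it is only used for \<^const>\<open>pairing\<close>,
  which is symmetric.\<close>

definition nondegenerate :: "('g::ab_group_add \<Rightarrow> 'g \<Rightarrow> complex) \<Rightarrow> bool"
  where "nondegenerate B \<longleftrightarrow> (\<forall>g. (\<forall>h. B g h = 1) \<longrightarrow> g = 0)"

definition metric_group :: "('g::{ab_group_add,finite} \<Rightarrow> complex) \<Rightarrow> bool"
  where "metric_group q \<longleftrightarrow>
    (\<forall>g. norm (q g) = 1) \<and>
    (\<forall>g. q (- g) = q g) \<and>
    bicharacter (pairing q) \<and> nondegenerate (pairing q)"

definition gauss_sum :: "('g::{ab_group_add,finite} \<Rightarrow> complex) \<Rightarrow> complex"
  where "gauss_sum q = 1 / complex_of_real (sqrt (real CARD('g))) * (\<Sum>g\<in>UNIV. q g)"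

definition two_torsion :: "'g::ab_group_add set"
  where "two_torsion = {g. g + g = 0}"

definition half_system :: "'g::ab_group_add set \<Rightarrow> bool"
  where "half_system H \<longleftrightarrow>
    UNIV = two_torsion \<union> H \<union> uminus ` H \<and>
    two_torsion \<inter> H = {} \<and> two_torsion \<inter> uminus ` H = {} \<and> H \<inter> uminus ` H = {}"

section \<open>Matrices indexed by a finite set\<close>

text \<open>A matrix is a function of two indices of which only the values on \<open>J \<times> J\<close> matter.
  The index set below depends on parameters, so it cannot be the index type of
  the matrices of \<^theory>\<open>HOL-Analysis.Finite_Cartesian_Product\<close>.\<close>

type_synonym 'j cmat = "'j \<Rightarrow> 'j \<Rightarrow> complex"

definition mat_eq :: "'j set \<Rightarrow> 'j cmat \<Rightarrow> 'j cmat \<Rightarrow> bool"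
  where "mat_eq J A B \<longleftrightarrow> (\<forall>i\<in>J. \<forall>j\<in>J. A i j = B i j)"

definition mat_mul :: "'j set \<Rightarrow> 'j cmat \<Rightarrow> 'j cmat \<Rightarrow> 'j cmat"
  where "mat_mul J A B = (\<lambda>i j. \<Sum>k\<in>J. A i k * B k j)"

definition mat_scale :: "complex \<Rightarrow> 'j cmat \<Rightarrow> 'j cmat"
  where "mat_scale z A = (\<lambda>i j. z * A i j)"

definition mat_one :: "'j cmat"
  where "mat_one = (\<lambda>i j. if i = j then 1 else 0)"

primrec mat_pow :: "'j set \<Rightarrow> 'j cmat \<Rightarrow> nat \<Rightarrow> 'j cmat"
  where
    "mat_pow J A 0 = mat_one"
  | "mat_pow J A (Suc n) = mat_mul J (mat_pow J A n) A"

definition adjoint_mat :: "'j cmat \<Rightarrow> 'j cmat"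
  where "adjoint_mat A = (\<lambda>i j. cnj (A j i))"

definition unitary_mat :: "'j set \<Rightarrow> 'j cmat \<Rightarrow> bool"
  where "unitary_mat J A \<longleftrightarrow>
    mat_eq J (mat_mul J A (adjoint_mat A)) mat_one \<and>
    mat_eq J (mat_mul J (adjoint_mat A) A) mat_one"

section \<open>The index set and the matrices S, T, C\<close>

text \<open>The constructors tag the blocks \<open>{0}\<close>, \<open>{\<pi>}\<close>, \<open>J\<^sub>1\<close>, \<open>G\<^sub>*\<close>, \<open>J\<^sub>2\<close>, \<open>\<Gamma>\<^sub>*\<close>,
  which makes the union in \<open>index_set\<close> disjoint. The signs
  \<open>\<epsilon>\<close> are complex numbers so that they can be multiplied by values of the pairing.\<close>

datatype ('g, 'h) idx =
    IZero | IPi | Fix1 "'g \<times> complex" | Orb1 'g | Fix2 "'h \<times> complex" | Orb2 'h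

definition index_set :: "'g \<Rightarrow> 'h \<Rightarrow> 'g set \<Rightarrow> 'h set \<Rightarrow> ('g, 'h) idx set"
  where "index_set g\<^sub>0 \<gamma>\<^sub>0 Gs \<Gamma>s =
    {IZero, IPi} \<union> Fix1 ` ({g\<^sub>0} \<times> {1, -1}) \<union> Orb1 ` Gs
      \<union> Fix2 ` ({\<gamma>\<^sub>0} \<times> {1, -1}) \<union> Orb2 ` \<Gamma>s"

text \<open>In \<open>S_blocks\<close>, \<open>B1\<close> and \<open>B2\<close> are the pairings on the two groups and
  \<open>r\<close> is the denominator \<open>2 \<surd>2\<close>.\<close>

fun S_blocks ::
  "complex \<Rightarrow> complex \<Rightarrow> complex \<Rightarrow> complex \<Rightarrow> ('g \<Rightarrow> 'g \<Rightarrow> complex) \<Rightarrow> ('h \<Rightarrow> 'h \<Rightarrow> complex)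
     \<Rightarrow> ('g, 'h) idx cmat"
  where
    "S_blocks a b s r B1 B2 IZero IZero = (a - b) / 2"
  | "S_blocks a b s r B1 B2 IZero IPi = (a + b) / 2"
  | "S_blocks a b s r B1 B2 IZero (Fix1 (g\<^sub>0', \<epsilon>')) = a / 2"
  | "S_blocks a b s r B1 B2 IZero (Orb1 g') = a"
  | "S_blocks a b s r B1 B2 IZero (Fix2 (\<gamma>\<^sub>0', \<epsilon>')) = b / 2"
  | "S_blocks a b s r B1 B2 IZero (Orb2 \<gamma>') = b"

  | "S_blocks a b s r B1 B2 IPi IZero = (a + b) / 2"
  | "S_blocks a b s r B1 B2 IPi IPi = (a - b) / 2"
  | "S_blocks a b s r B1 B2 IPi (Fix1 (g\<^sub>0', \<epsilon>')) = a / 2"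
  | "S_blocks a b s r B1 B2 IPi (Orb1 g') = a"
  | "S_blocks a b s r B1 B2 IPi (Fix2 (\<gamma>\<^sub>0', \<epsilon>')) = - (b / 2)"
  | "S_blocks a b s r B1 B2 IPi (Orb2 \<gamma>') = - b"

  | "S_blocks a b s r B1 B2 (Fix1 (g\<^sub>0, \<epsilon>)) IZero = a / 2"
  | "S_blocks a b s r B1 B2 (Fix1 (g\<^sub>0, \<epsilon>)) IPi = a / 2"
  | "S_blocks a b s r B1 B2 (Fix1 (g\<^sub>0, \<epsilon>)) (Fix1 (g\<^sub>0', \<epsilon>')) =
       (a / 2 + \<epsilon> * \<epsilon>' * s / r) * B1 g\<^sub>0 g\<^sub>0'"
  | "S_blocks a b s r B1 B2 (Fix1 (g\<^sub>0, \<epsilon>)) (Orb1 g') = a * B1 g\<^sub>0 g'"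
  | "S_blocks a b s r B1 B2 (Fix1 (g\<^sub>0, \<epsilon>)) (Fix2 (\<gamma>\<^sub>0', \<epsilon>')) = \<epsilon> * \<epsilon>' * s / r"
  | "S_blocks a b s r B1 B2 (Fix1 (g\<^sub>0, \<epsilon>)) (Orb2 \<gamma>') = 0"

  | "S_blocks a b s r B1 B2 (Orb1 g) IZero = a"
  | "S_blocks a b s r B1 B2 (Orb1 g) IPi = a"
  | "S_blocks a b s r B1 B2 (Orb1 g) (Fix1 (g\<^sub>0', \<epsilon>')) = a * B1 g g\<^sub>0'"
  | "S_blocks a b s r B1 B2 (Orb1 g) (Orb1 g') = a * (B1 g g' + cnj (B1 g g'))"
  | "S_blocks a b s r B1 B2 (Orb1 g) (Fix2 (\<gamma>\<^sub>0', \<epsilon>')) = 0"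
  | "S_blocks a b s r B1 B2 (Orb1 g) (Orb2 \<gamma>') = 0"

  | "S_blocks a b s r B1 B2 (Fix2 (\<gamma>\<^sub>0, \<epsilon>)) IZero = b / 2"
  | "S_blocks a b s r B1 B2 (Fix2 (\<gamma>\<^sub>0, \<epsilon>)) IPi = - (b / 2)"
  | "S_blocks a b s r B1 B2 (Fix2 (\<gamma>\<^sub>0, \<epsilon>)) (Fix1 (g\<^sub>0', \<epsilon>')) = \<epsilon> * \<epsilon>' * s / r"
  | "S_blocks a b s r B1 B2 (Fix2 (\<gamma>\<^sub>0, \<epsilon>)) (Orb1 g') = 0"
  | "S_blocks a b s r B1 B2 (Fix2 (\<gamma>\<^sub>0, \<epsilon>)) (Fix2 (\<gamma>\<^sub>0', \<epsilon>')) =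
       - ((b / 2 - \<epsilon> * \<epsilon>' * s / r) * B2 \<gamma>\<^sub>0 \<gamma>\<^sub>0')"
  | "S_blocks a b s r B1 B2 (Fix2 (\<gamma>\<^sub>0, \<epsilon>)) (Orb2 \<gamma>') = - (b * B2 \<gamma>\<^sub>0 \<gamma>')"

  | "S_blocks a b s r B1 B2 (Orb2 \<gamma>) IZero = b"
  | "S_blocks a b s r B1 B2 (Orb2 \<gamma>) IPi = - b"
  | "S_blocks a b s r B1 B2 (Orb2 \<gamma>) (Fix1 (g\<^sub>0', \<epsilon>')) = 0"
  | "S_blocks a b s r B1 B2 (Orb2 \<gamma>) (Orb1 g') = 0"
  | "S_blocks a b s r B1 B2 (Orb2 \<gamma>) (Fix2 (\<gamma>\<^sub>0', \<epsilon>')) = - (b * B2 \<gamma> \<gamma>\<^sub>0')"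
  | "S_blocks a b s r B1 B2 (Orb2 \<gamma>) (Orb2 \<gamma>') = - (b * (B2 \<gamma> \<gamma>' + cnj (B2 \<gamma> \<gamma>')))"

definition S_mat ::
  "complex \<Rightarrow> ('g::{ab_group_add,finite} \<Rightarrow> complex) \<Rightarrow> ('h::{ab_group_add,finite} \<Rightarrow> complex)
     \<Rightarrow> 'g \<Rightarrow> 'h \<Rightarrow> ('g, 'h) idx cmat"
  where "S_mat c q\<^sub>1 q\<^sub>2 g\<^sub>0 \<gamma>\<^sub>0 =
    (let a = 1 / complex_of_real (sqrt (real CARD('g)));
         b = 1 / complex_of_real (sqrt (real CARD('h)));
         s = c * ((inverse (q\<^sub>1 g\<^sub>0) + inverse (q\<^sub>2 \<gamma>\<^sub>0)) / complex_of_real (sqrt 2));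
         r = 2 * complex_of_real (sqrt 2)
     in S_blocks a b s r (pairing q\<^sub>1) (pairing q\<^sub>2))"

fun T_entry :: "('g \<Rightarrow> complex) \<Rightarrow> ('h \<Rightarrow> complex) \<Rightarrow> ('g, 'h) idx \<Rightarrow> complex"
  where
    "T_entry q\<^sub>1 q\<^sub>2 IZero = 1"
  | "T_entry q\<^sub>1 q\<^sub>2 IPi = 1"
  | "T_entry q\<^sub>1 q\<^sub>2 (Fix1 (g\<^sub>0, \<epsilon>)) = q\<^sub>1 g\<^sub>0"
  | "T_entry q\<^sub>1 q\<^sub>2 (Orb1 g) = q\<^sub>1 g"
  | "T_entry q\<^sub>1 q\<^sub>2 (Fix2 (\<gamma>\<^sub>0, \<epsilon>)) = q\<^sub>2 \<gamma>\<^sub>0"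
  | "T_entry q\<^sub>1 q\<^sub>2 (Orb2 \<gamma>) = q\<^sub>2 \<gamma>"

definition T_mat :: "('g \<Rightarrow> complex) \<Rightarrow> ('h \<Rightarrow> complex) \<Rightarrow> ('g, 'h) idx cmat"
  where "T_mat q\<^sub>1 q\<^sub>2 = (\<lambda>i j. if i = j then T_entry q\<^sub>1 q\<^sub>2 i else 0)"

text \<open>The parameter \<open>w\<close> is \<open>\<langle>g\<^sub>0, g\<^sub>0\<rangle>\<close>; it acts on the signs of both \<open>J\<^sub>1\<close> and \<open>J\<^sub>2\<close>.\<close>

fun idx_bar :: "complex \<Rightarrow> ('g, 'h) idx \<Rightarrow> ('g, 'h) idx"
  where
    "idx_bar w IZero = IZero"
  | "idx_bar w IPi = IPi"
  | "idx_bar w (Fix1 (g\<^sub>0, \<epsilon>)) = Fix1 (g\<^sub>0, w * \<epsilon>)"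
  | "idx_bar w (Orb1 g) = Orb1 g"
  | "idx_bar w (Fix2 (\<gamma>\<^sub>0, \<epsilon>)) = Fix2 (\<gamma>\<^sub>0, w * \<epsilon>)"
  | "idx_bar w (Orb2 \<gamma>) = Orb2 \<gamma>"

definition C_mat :: "('g::ab_group_add \<Rightarrow> complex) \<Rightarrow> 'g \<Rightarrow> ('g, 'h) idx cmat"
  where "C_mat q\<^sub>1 g\<^sub>0 = (\<lambda>i j. if idx_bar (pairing q\<^sub>1 g\<^sub>0 g\<^sub>0) i = j then 1 else 0)"

end

theory Submission
  imports Defs
begin

text \<open>Up to normalisation, \<open>J\<close> indexes an orthonormal basis of the direct sum of the even functions on
  \<open>G\<close>, the even functions on \<open>\<Gamma>\<close>, and a plane. In it \<open>S\<close> is the Fourier transform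
  of \<open>G\<close> plus minus the Fourier transform of \<open>\<Gamma>\<close> plus a \<open>2 \<times> 2\<close> block, and \<open>T\<close> is
  multiplication by \<open>q\<^sub>1\<close>, by \<open>q\<^sub>2\<close> and by their values at the points of order two. All relations can therefore
  be checked summand by summand. On the Fourier parts, completing the square gives the Gauss sums
  \<open>c\<close> and \<open>- (- c)\<close> as the values of \<open>(ST)\<^sup>3\<close>; on the plane they reduce to
  \<open>q\<^sub>1(g\<^sub>0)\<^sup>2 = \<langle>g\<^sub>0, g\<^sub>0\<rangle> = - q\<^sub>2(\<gamma>\<^sub>0)\<^sup>2\<close> and
  the formula for \<open>c\<^sup>2\<close>.\<close>

section \<open>Matrices over finite types\<close>

lemma sum_mat_one_left [simp]: "(\<Sum>k\<in>UNIV. mat_one g k * f k) = f (g::'k::finite)"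
proof -
  have "(\<Sum>k\<in>UNIV. mat_one g k * f k) = (\<Sum>k\<in>UNIV. if g = k then f k else 0)"
    by (rule sum.cong) (auto simp: mat_one_def)
  then show ?thesis by simp
qed

lemma mat_one_commute: "mat_one g k = mat_one k g"
  by (simp add: mat_one_def)

lemma sum_mat_one_right [simp]: "(\<Sum>k\<in>UNIV. f k * mat_one k g) = f (g::'k::finite)"
  using sum_mat_one_left[of g f] by (simp add: mat_one_commute mult.commute)

lemma sum_mat_one_right' [simp]: "(\<Sum>k\<in>UNIV. f k * mat_one g k) = f (g::'k::finite)"
  using sum_mat_one_left[of g f] by (simp add: mult.commute)

lemma mat_mul_assoc: "mat_mul J (mat_mul J A B) C = mat_mul J A (mat_mul J B C)"
proof (intro ext)
  fix i j
  have "(\<Sum>k\<in>J. (\<Sum>l\<in>J. A i l * B l k) * C k j) = (\<Sum>k\<in>J. \<Sum>l\<in>J. A i l * B l k * C k j)"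
    by (simp add: sum_distrib_right)
  also have "\<dots> = (\<Sum>l\<in>J. \<Sum>k\<in>J. A i l * B l k * C k j)"
    by (rule sum.swap)
  also have "\<dots> = (\<Sum>l\<in>J. A i l * (\<Sum>k\<in>J. B l k * C k j))"
    by (simp add: sum_distrib_left mult.assoc)
  finally show "mat_mul J (mat_mul J A B) C i j = mat_mul J A (mat_mul J B C) i j"
    by (simp add: mat_mul_def)
qed

lemma mat_mul_scale [simp]:
  "mat_mul J (mat_scale z A) B = mat_scale z (mat_mul J A B)"
  "mat_mul J A (mat_scale z B) = mat_scale z (mat_mul J A B)"
  by (simp_all add: mat_mul_def mat_scale_def sum_distrib_left algebra_simps)

lemma mat_scale_scale [simp]: "mat_scale y (mat_scale z A) = mat_scale (y * z) A"
  by (simp add: mat_scale_def mult.assoc)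

lemma mat_scale_one [simp]: "mat_scale 1 A = A"
  by (simp add: mat_scale_def)

lemma mat_eq_refl [simp]: "mat_eq J A A"
  by (simp add: mat_eq_def)

lemma mat_eq_trans: "mat_eq J A B \<Longrightarrow> mat_eq J B C \<Longrightarrow> mat_eq J A C"
  by (simp add: mat_eq_def)

lemma mat_eq_sym: "mat_eq J A B \<Longrightarrow> mat_eq J B A"
  by (simp add: mat_eq_def)

lemma mat_eq_mul: "mat_eq J A A' \<Longrightarrow> mat_eq J B B' \<Longrightarrow> mat_eq J (mat_mul J A B) (mat_mul J A' B')"
  by (simp add: mat_eq_def mat_mul_def)

lemma mat_eq_adjoint: "mat_eq J A A' \<Longrightarrow> mat_eq J (adjoint_mat A) (adjoint_mat A')"
  by (simp add: mat_eq_def adjoint_mat_def)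

lemma mat_eq_scale: "mat_eq J A B \<Longrightarrow> mat_eq J (mat_scale z A) (mat_scale z B)"
  by (simp add: mat_eq_def mat_scale_def)

lemma mat_eq_UNIV: "mat_eq UNIV A B \<longleftrightarrow> A = B"
  by (auto simp: mat_eq_def fun_eq_iff)

lemma unitary_mat_cong: "mat_eq J A B \<Longrightarrow> unitary_mat J B \<Longrightarrow> unitary_mat J A"
  unfolding unitary_mat_def by (meson mat_eq_adjoint mat_eq_mul mat_eq_trans)

text \<open>\<open>mat_pow\<close> starts from \<open>mat_one\<close>, which is neutral up to
  \<open>mat_eq J\<close> for finite \<open>J\<close>, where the sum over \<open>J\<close> picks out
  a single term.\<close>

lemma mat_pow_3: "finite J \<Longrightarrow> mat_eq J (mat_pow J A 3) (mat_mul J A (mat_mul J A A))"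
proof -
  assume "finite J"
  then have "mat_eq J (mat_mul J mat_one A) A"
    by (simp add: mat_eq_def mat_mul_def mat_one_def if_distrib[of "\<lambda>x. x * _"] cong: if_cong)
  then have "mat_eq J (mat_mul J (mat_mul J (mat_mul J mat_one A) A) A) (mat_mul J (mat_mul J A A) A)"
    by (intro mat_eq_mul mat_eq_refl)
  then show ?thesis by (simp add: numeral_3_eq_3 mat_mul_assoc)
qed

section \<open>Diagonal matrices\<close>

definition diag_mat :: "('k \<Rightarrow> complex) \<Rightarrow> 'k cmat"
  where "diag_mat x = (\<lambda>k l. x k * mat_one k l)"

lemma diag_mat_apply: "diag_mat x k l = (if k = l then x k else 0)"
  by (simp add: diag_mat_def mat_one_def)

lemma diag_mat_one: "diag_mat (\<lambda>_. 1) = mat_one"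
  by (simp add: diag_mat_def)

lemma mat_mul_diag:
  "mat_mul UNIV (A::'k::finite cmat) (diag_mat x) = (\<lambda>k l. A k l * x l)"
  by (simp add: mat_mul_def diag_mat_def fun_eq_iff mult.assoc[symmetric])

lemma diag_mul_diag:
  "mat_mul UNIV (diag_mat x) (diag_mat y) = diag_mat (\<lambda>k::'k::finite. x k * y k)"
  unfolding mat_mul_diag by (auto simp: diag_mat_def fun_eq_iff mat_one_def)

lemma adjoint_diag: "adjoint_mat (diag_mat x) = diag_mat (\<lambda>k. cnj (x k))"
  by (auto simp: adjoint_mat_def diag_mat_def mat_one_def fun_eq_iff)

lemma unitary_diag:
  fixes x :: "'k::finite \<Rightarrow> complex"
  assumes "\<And>k. norm (x k) = 1"
  shows "unitary_mat UNIV (diag_mat x)"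
proof -
  have "x k * cnj (x k) = 1" for k
    using assms[of k] by (simp add: complex_norm_square[symmetric])
  then show ?thesis
    by (simp add: unitary_mat_def mat_eq_UNIV adjoint_diag diag_mul_diag diag_mat_one mult.commute)
qed

section \<open>Block matrices over a sum type\<close>

lemma mat_one_sum [simp]:
  "mat_one (Inl k) (Inl l) = mat_one k l" "mat_one (Inr x) (Inr y) = mat_one x y"
  "mat_one (Inl k) (Inr y) = 0" "mat_one (Inr x) (Inl l) = 0"
  by (simp_all add: mat_one_def)

text \<open>Over this index type relations can be stated on \<open>UNIV\<close>, where
  \<open>mat_eq_UNIV\<close> turns them into equations. The summand \<open>bool\<close> indexes the
  plane.\<close>

definition block_diag :: "'g cmat \<Rightarrow> 'h cmat \<Rightarrow> bool cmat \<Rightarrow> (('g + 'h) + bool) cmat"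
  where "block_diag A B M = (\<lambda>k l. case (k, l) of
      (Inl (Inl g), Inl (Inl g')) \<Rightarrow> A g g'
    | (Inl (Inr h), Inl (Inr h')) \<Rightarrow> B h h'
    | (Inr x, Inr y) \<Rightarrow> M x y
    | _ \<Rightarrow> 0)"

lemma block_diag_simps [simp]:
  "block_diag A B M (Inl (Inl g)) (Inl (Inl g')) = A g g'"
  "block_diag A B M (Inl (Inl g)) (Inl (Inr h')) = 0"
  "block_diag A B M (Inl (Inr h)) (Inl (Inl g')) = 0"
  "block_diag A B M (Inl (Inr h)) (Inl (Inr h')) = B h h'"
  "block_diag A B M (Inl k) (Inr y) = 0"
  "block_diag A B M (Inr x) (Inl k) = 0"
  "block_diag A B M (Inr x) (Inr y) = M x y"
  by (simp_all add: block_diag_def split: sum.splits)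

lemma sum_UNIV_sum:
  "(\<Sum>k\<in>(UNIV :: ('g::finite + 'h::finite) set). f k) = (\<Sum>g\<in>UNIV. f (Inl g)) + (\<Sum>h\<in>UNIV. f (Inr h))"
  by (simp add: UNIV_Plus_UNIV[symmetric] sum.Plus del: UNIV_Plus_UNIV)

lemma block_index_cases:
  fixes k :: "('g + 'h) + bool"
  obtains g where "k = Inl (Inl g)" | h where "k = Inl (Inr h)" | x where "k = Inr x"
  by (metis sum.exhaust)

lemma eq_matI3:
  fixes X Y :: "(('g + 'h) + bool) cmat"
  assumes "\<And>g g'. X (Inl (Inl g)) (Inl (Inl g')) = Y (Inl (Inl g)) (Inl (Inl g'))"
    and "\<And>g h. X (Inl (Inl g)) (Inl (Inr h)) = Y (Inl (Inl g)) (Inl (Inr h))"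
    and "\<And>h g. X (Inl (Inr h)) (Inl (Inl g)) = Y (Inl (Inr h)) (Inl (Inl g))"
    and "\<And>h h'. X (Inl (Inr h)) (Inl (Inr h')) = Y (Inl (Inr h)) (Inl (Inr h'))"
    and "\<And>k y. X (Inl k) (Inr y) = Y (Inl k) (Inr y)"
    and "\<And>x k. X (Inr x) (Inl k) = Y (Inr x) (Inl k)"
    and "\<And>x y. X (Inr x) (Inr y) = Y (Inr x) (Inr y)"
  shows "X = Y"
proof (intro ext)
  fix k l
  show "X k l = Y k l"
    by (cases k rule: block_index_cases; cases l rule: block_index_cases) (simp_all add: assms)
qed

lemma mat_mul_block_diag:
  fixes A A' :: "'g::finite cmat" and B B' :: "'h::finite cmat"
  shows "mat_mul UNIV (block_diag A B M) (block_diag A' B' M') =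
    block_diag (mat_mul UNIV A A') (mat_mul UNIV B B') (mat_mul UNIV M M')"
  by (rule eq_matI3) (simp_all add: mat_mul_def sum_UNIV_sum block_diag_def split: sum.splits)

lemma adjoint_block_diag:
  "adjoint_mat (block_diag A B M) = block_diag (adjoint_mat A) (adjoint_mat B) (adjoint_mat M)"
  by (rule eq_matI3) (simp_all add: adjoint_mat_def)

lemma block_diag_one: "block_diag mat_one mat_one mat_one = mat_one"
  by (rule eq_matI3) (simp_all add: mat_one_def)

lemma mat_scale_block_diag:
  "mat_scale z (block_diag A B M) = block_diag (mat_scale z A) (mat_scale z B) (mat_scale z M)"
  by (rule eq_matI3) (simp_all add: mat_scale_def)

lemma unitary_block_diag:
  fixes A :: "'g::finite cmat" and B :: "'h::finite cmat"
  assumes "unitary_mat UNIV A" "unitary_mat UNIV B" "unitary_mat UNIV M"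
  shows "unitary_mat UNIV (block_diag A B M)"
  using assms
  by (simp add: unitary_mat_def mat_eq_UNIV adjoint_block_diag mat_mul_block_diag block_diag_one)

section \<open>Compression to invariant vectors\<close>

text \<open>No conjugate is taken of \<open>u\<close>: the form is evaluated on real frame vectors,
  where it agrees with the Hermitian one.\<close>

definition bilin :: "'k::finite cmat \<Rightarrow> ('k \<Rightarrow> complex) \<Rightarrow> ('k \<Rightarrow> complex) \<Rightarrow> complex"
  where "bilin A u v = (\<Sum>k\<in>UNIV. \<Sum>l\<in>UNIV. u k * A k l * v l)"

lemma bilin_simps [simp]:
  "bilin A (\<lambda>k. u k + u' k) v = bilin A u v + bilin A u' v"
  "bilin A u (\<lambda>k. v k + v' k) = bilin A u v + bilin A u v'"
  "bilin A (\<lambda>k. - u k) v = - bilin A u v"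
  "bilin A u (\<lambda>k. - v k) = - bilin A u v"
  "bilin A (\<lambda>k. 0) v = 0"
  "bilin A u (\<lambda>k. 0) = 0"
  by (simp_all add: bilin_def sum.distrib algebra_simps sum_negf)

lemma bilin_mat_one [simp]: "bilin A (mat_one g) (mat_one h) = A g h"
proof -
  have "bilin A (mat_one g) (mat_one h) = (\<Sum>k\<in>UNIV. mat_one g k * (\<Sum>l\<in>UNIV. A k l * mat_one h l))"
    by (simp add: bilin_def sum_distrib_left mult.assoc del: sum_mat_one_right')
  then show ?thesis by simp
qed

lemma bilin_scale_mat: "bilin (mat_scale z A) u v = z * bilin A u v"
  by (simp add: bilin_def mat_scale_def sum_distrib_left algebra_simps)

text \<open>The vectors \<open>W j / \<surd>2\<close> form an orthonormal system spanning the \<open>\<nu>\<close>-invariant vectors, so that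
  compression is multiplicative on the matrices commuting with \<open>\<nu>\<close>.\<close>

locale invariant_frame =
  fixes J :: "'j set" and W :: "'j \<Rightarrow> 'k::finite \<Rightarrow> complex" and \<nu> :: "'k \<Rightarrow> 'k"
  assumes frame: "\<And>k l. (\<Sum>j\<in>J. W j k * W j l) = mat_one k l + mat_one (\<nu> k) l"
    and involution: "\<And>k. \<nu> (\<nu> k) = k"
    and invariant: "\<And>j k. j \<in> J \<Longrightarrow> W j (\<nu> k) = W j k"
    and real: "\<And>j k. j \<in> J \<Longrightarrow> cnj (W j k) = W j k"
    and compress_one: "mat_eq J (\<lambda>i j. bilin mat_one (W i) (W j) / 2) mat_one"
begin

definition compress :: "'k cmat \<Rightarrow> 'j cmat"
  where "compress A = (\<lambda>i j. bilin A (W i) (W j) / 2)"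

text \<open>As \<nu> is an involution, this says that \<open>A\<close> commutes with the permutation
  matrix of \<nu>.\<close>

definition equivariant :: "'k cmat \<Rightarrow> bool"
  where "equivariant A \<longleftrightarrow> (\<forall>k l. A (\<nu> k) l = A k (\<nu> l))"

lemma sum_reindex_involution: "(\<Sum>k\<in>UNIV. f (\<nu> k)) = (\<Sum>k\<in>UNIV. f k)"
  by (rule sum.reindex_bij_witness[of _ \<nu> \<nu>]) (auto simp: involution)

text \<open>By \<open>frame\<close>, summing over \<open>J\<close> inserts the matrix 1 + \<nu>
  between the factors. Equivariance of \<open>B\<close> makes \<open>Y\<close>, the image of
  \<open>W j\<close> under \<open>B\<close>, invariant, so both terms contribute equally; the
  resulting 2 merges the two halves of the normalisation into one.\<close>

lemma compress_mul:
  assumes "equivariant B"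
  shows "mat_eq J (mat_mul J (compress A) (compress B)) (compress (mat_mul UNIV A B))"
  unfolding mat_eq_def
proof (intro ballI)
  fix i j assume j: "j \<in> J"
  define X where "X l = (\<Sum>k\<in>UNIV. W i k * A k l)" for l
  define Y where "Y m = (\<Sum>n\<in>UNIV. B m n * W j n)" for m
  have X: "compress A i p = (\<Sum>l\<in>UNIV. X l * W p l) / 2" for p
    unfolding compress_def bilin_def X_def by (subst sum.swap) (simp add: sum_distrib_right)
  have Y: "compress B p j = (\<Sum>m\<in>UNIV. W p m * Y m) / 2" for p
    by (simp add: compress_def bilin_def Y_def sum_distrib_left mult.assoc)
  have Y_inv: "Y (\<nu> l) = Y l" for l
  proof -
    have "Y (\<nu> l) = (\<Sum>n\<in>UNIV. B l (\<nu> n) * W j (\<nu> n))"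
      using assms j by (simp add: Y_def equivariant_def invariant)
    also have "\<dots> = Y l"
      unfolding Y_def by (rule sum_reindex_involution)
    finally show ?thesis .
  qed
  have "mat_mul J (compress A) (compress B) i j
      = (\<Sum>p\<in>J. \<Sum>l\<in>UNIV. \<Sum>m\<in>UNIV. X l * Y m * (W p l * W p m)) / 4"
    by (simp add: mat_mul_def X Y sum_product sum_divide_distrib algebra_simps)
  also have "(\<Sum>p\<in>J. \<Sum>l\<in>UNIV. \<Sum>m\<in>UNIV. X l * Y m * (W p l * W p m))
      = (\<Sum>l\<in>UNIV. \<Sum>m\<in>UNIV. \<Sum>p\<in>J. X l * Y m * (W p l * W p m))"
    by (subst sum.swap, rule sum.cong[OF refl], subst sum.swap, rule refl)
  also have "\<dots> = (\<Sum>l\<in>UNIV. \<Sum>m\<in>UNIV. X l * Y m * (mat_one l m + mat_one (\<nu> l) m))"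
    by (simp only: sum_distrib_left[symmetric] frame)
  also have "\<dots> = (\<Sum>l\<in>UNIV. X l * (Y l + Y (\<nu> l)))"
    by (simp add: distrib_left sum.distrib mult.assoc sum_distrib_left[symmetric])
  also have "\<dots> = 2 * (\<Sum>l\<in>UNIV. X l * Y l)"
    by (simp add: Y_inv sum_distrib_left algebra_simps)
  also have "(\<Sum>l\<in>UNIV. X l * Y l)
      = (\<Sum>l\<in>UNIV. \<Sum>k\<in>UNIV. \<Sum>n\<in>UNIV. W i k * (A k l * B l n) * W j n)"
    by (simp add: X_def Y_def sum_product algebra_simps)
  also have "\<dots> = (\<Sum>k\<in>UNIV. \<Sum>n\<in>UNIV. \<Sum>l\<in>UNIV. W i k * (A k l * B l n) * W j n)"
    by (subst sum.swap, rule sum.cong[OF refl], subst sum.swap, rule refl)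
  also have "\<dots> = bilin (mat_mul UNIV A B) (W i) (W j)"
    by (simp add: bilin_def mat_mul_def sum_distrib_left sum_distrib_right)
  finally show "mat_mul J (compress A) (compress B) i j = compress (mat_mul UNIV A B) i j"
    by (simp add: compress_def)
qed

lemma compress_mat_one: "mat_eq J (compress mat_one) mat_one"
  using compress_one by (simp add: compress_def)

text \<open>Substituting \<open>\<nu> l\<close> for \<open>l\<close> moves the reflection onto
  \<open>W j\<close>, which absorbs it. This turns the reflection in the square of a Fourier matrix
  into the identity on \<open>J\<close>.\<close>

lemma compress_reflect:
  assumes "\<And>k l. B k l = A k (\<nu> l)"
  shows "mat_eq J (compress B) (compress A)"
  unfolding mat_eq_def
proof (intro ballI)
  fix i j assume j: "j \<in> J"
  have "(\<Sum>l\<in>UNIV. W i k * B k l * W j l) = (\<Sum>l\<in>UNIV. W i k * A k l * W j l)" for k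
    using sum_reindex_involution[of "\<lambda>l. W i k * A k l * W j l"] j
    by (simp add: assms invariant)
  then show "compress B i j = compress A i j"
    by (simp add: compress_def bilin_def)
qed

lemma equivariant_mul:
  assumes "equivariant A" "equivariant B"
  shows "equivariant (mat_mul UNIV A B)"
proof -
  have "(\<Sum>m\<in>UNIV. A (\<nu> k) m * B m l) = (\<Sum>m\<in>UNIV. A k m * B m (\<nu> l))" for k l
    using assms sum_reindex_involution[of "\<lambda>m. A k m * B m (\<nu> l)"]
    by (simp add: equivariant_def involution)
  then show ?thesis by (simp add: equivariant_def mat_mul_def)
qed

lemma equivariant_adjoint: "equivariant A \<Longrightarrow> equivariant (adjoint_mat A)"
  by (simp add: equivariant_def adjoint_mat_def)

text \<open>The frame is real, so conjugation only reaches the entries of \<open>A\<close>; swapping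
  the two sums transposes them.\<close>

lemma adjoint_compress: "mat_eq J (adjoint_mat (compress A)) (compress (adjoint_mat A))"
  unfolding mat_eq_def
proof (intro ballI)
  fix i j assume "i \<in> J" "j \<in> J"
  then have "cnj (bilin A (W j) (W i)) = (\<Sum>k\<in>UNIV. \<Sum>l\<in>UNIV. W j k * cnj (A k l) * W i l)"
    by (simp add: bilin_def real)
  also have "\<dots> = bilin (adjoint_mat A) (W i) (W j)"
    by (subst sum.swap) (simp add: bilin_def adjoint_mat_def algebra_simps)
  finally show "adjoint_mat (compress A) i j = compress (adjoint_mat A) i j"
    by (simp add: adjoint_mat_def compress_def)
qed

lemma unitary_compress:
  assumes "unitary_mat UNIV A" "equivariant A"
  shows "unitary_mat J (compress A)"
proof -
  have "mat_eq J (mat_mul J (compress A) (adjoint_mat (compress A))) (compress mat_one)"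
    using mat_eq_trans[OF mat_eq_mul[OF mat_eq_refl adjoint_compress]
        compress_mul[OF equivariant_adjoint[OF assms(2)]], of A] assms(1)
    by (simp add: unitary_mat_def mat_eq_UNIV)
  moreover have "mat_eq J (mat_mul J (adjoint_mat (compress A)) (compress A)) (compress mat_one)"
    using mat_eq_trans[OF mat_eq_mul[OF adjoint_compress mat_eq_refl]
        compress_mul[OF assms(2)], of A] assms(1)
    by (simp add: unitary_mat_def mat_eq_UNIV)
  ultimately show ?thesis
    unfolding unitary_mat_def using compress_mat_one mat_eq_trans by blast
qed

lemma compress_scale: "compress (mat_scale z A) = mat_scale z (compress A)"
  by (simp add: compress_def bilin_scale_mat) (simp add: mat_scale_def)

end

section \<open>The Fourier matrix of a metric group\<close>

definition fourier :: "('g::{ab_group_add,finite} \<Rightarrow> complex) \<Rightarrow> 'g cmat"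
  where "fourier q = (\<lambda>g h. 1 / complex_of_real (sqrt (real CARD('g))) * pairing q g h)"

context
  fixes q :: "'g::{ab_group_add,finite} \<Rightarrow> complex"
  assumes q: "metric_group q"
begin

lemma q_norm: "norm (q g) = 1" and q_minus: "q (- g) = q g"
  using q by (auto simp: metric_group_def)

lemma q_nz: "q g \<noteq> 0"
  using q_norm[of g] by auto

lemma pairing_norm: "norm (pairing q g h) = 1"
  and pairing_add_left: "pairing q (g + g') h = pairing q g h * pairing q g' h"
  and pairing_add_right: "pairing q g (h + h') = pairing q g h * pairing q g h'"
  using q by (auto simp: metric_group_def bicharacter_def)

lemma pairing_nz: "pairing q g h \<noteq> 0"
  using pairing_norm[of g h] by auto

lemma pairing_commute: "pairing q g h = pairing q h g"
  by (simp add: pairing_def add.commute)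

lemma q_add: "q (g + h) = q g * q h * pairing q g h"
  by (simp add: pairing_def q_nz field_simps)

lemma pairing_zero: "pairing q 0 h = 1" "pairing q h 0 = 1"
  using pairing_add_left[of 0 0 h] pairing_nz[of 0 h] pairing_commute[of h 0] by auto

lemma q_zero: "q 0 = 1"
  using pairing_zero(1)[of 0] q_nz[of 0] by (simp add: pairing_def field_simps)

text \<open>Both sides are inverse to \<open>pairing q g h\<close>: one by additivity, the other
  because its norm is 1.\<close>

lemma pairing_minus: "pairing q (- g) h = cnj (pairing q g h)" "pairing q g (- h) = cnj (pairing q g h)"
proof -
  have "pairing q g h * pairing q (- g) h = 1" for g h
    using pairing_add_left[of g "- g" h] by (simp add: pairing_zero)
  moreover have "pairing q g h * cnj (pairing q g h) = 1" for g h
    using pairing_norm[of g h] by (simp add: complex_norm_square[symmetric])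
  ultimately have *: "pairing q (- g) h = cnj (pairing q g h)" for g h
    by (metis mult_left_cancel pairing_nz)
  show "pairing q (- g) h = cnj (pairing q g h)" "pairing q g (- h) = cnj (pairing q g h)"
    using *[of g h] *[of h g] by (simp_all add: pairing_commute[of g])
qed

text \<open>Orthogonality of characters: for nonzero \<open>g\<close> non-degeneracy yields
  \<open>h'\<close> with a pairing value other than 1, and shifting by \<open>h'\<close> multiplies
  the sum by that value, so it vanishes.\<close>

lemma sum_pairing: "(\<Sum>h\<in>UNIV. pairing q g h) = of_nat CARD('g) * mat_one g 0"
proof (cases "g = 0")
  case True
  then show ?thesis by (simp add: pairing_zero mat_one_def)
next
  case False
  then obtain h' where h': "pairing q g h' \<noteq> 1"
    using q unfolding metric_group_def nondegenerate_def by blast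
  have "(\<Sum>h\<in>UNIV. pairing q g h) = (\<Sum>h\<in>UNIV. pairing q g (h' + h))"
    by (rule sum.reindex_bij_witness[of _ "\<lambda>h. h' + h" "\<lambda>h. h - h'"]) auto
  also have "\<dots> = pairing q g h' * (\<Sum>h\<in>UNIV. pairing q g h)"
    by (simp add: pairing_add_right sum_distrib_left)
  finally have "(\<Sum>h\<in>UNIV. pairing q g h) = 0"
    using h' by simp
  with False show ?thesis by (simp add: mat_one_def)
qed

lemma sqrt_card_square: 
  "complex_of_real (sqrt (real CARD('g))) * complex_of_real (sqrt (real CARD('g))) = of_nat CARD('g)"
  by (simp flip: of_real_mult)

text \<open>Neither factor is conjugated, so row \<open>g\<close> and column \<open>h\<close> meet
  in the character of \<open>g + h\<close>, whose sum is supported at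
  \<open>g = - h\<close>.\<close>

lemma fourier_square: "mat_mul UNIV (fourier q) (fourier q) = (\<lambda>g h. mat_one g (- h))"
proof (intro ext)
  fix g h
  have "mat_mul UNIV (fourier q) (fourier q) g h
      = (\<Sum>k\<in>UNIV. pairing q (g + h) k) / of_nat CARD('g)"
    by (simp add: mat_mul_def fourier_def pairing_add_left pairing_commute[of _ h]
        sum_divide_distrib sqrt_card_square)
  also have "\<dots> = mat_one g (- h)"
    by (simp add: sum_pairing mat_one_def eq_neg_iff_add_eq_0)
  finally show "mat_mul UNIV (fourier q) (fourier q) g h = mat_one g (- h)" .
qed

lemma fourier_minus: "fourier q (- g) h = fourier q g (- h)"
  by (simp add: fourier_def pairing_minus)

lemma adjoint_fourier: "adjoint_mat (fourier q) = (\<lambda>g h. fourier q g (- h))"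
  by (simp add: adjoint_mat_def fourier_def pairing_minus pairing_commute fun_eq_iff)

lemma fourier_inverse:
  "mat_mul UNIV (fourier q) (\<lambda>g h. fourier q g (- h)) = mat_one"
  "mat_mul UNIV (\<lambda>g h. fourier q g (- h)) (fourier q) = mat_one"
proof -
  show "mat_mul UNIV (fourier q) (\<lambda>g h. fourier q g (- h)) = mat_one"
    using fourier_square by (simp add: mat_mul_def fun_eq_iff)
  show "mat_mul UNIV (\<lambda>g h. fourier q g (- h)) (fourier q) = mat_one"
    using fourier_square by (simp add: mat_mul_def fun_eq_iff mat_one_def flip: fourier_minus)
qed

lemma unitary_fourier: "unitary_mat UNIV (fourier q)"
  by (simp add: unitary_mat_def mat_eq_UNIV adjoint_fourier fourier_inverse)

text \<open>Completing the square \<open>q k * pairing q k (g + h) = q (k + g + h) / q (g + h)\<close> turns the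
  product into a Gauss sum.\<close>

lemma fourier_diag_fourier:
  "mat_mul UNIV (mat_mul UNIV (fourier q) (diag_mat q)) (fourier q) g h
    = gauss_sum q * fourier q g (- h) / (q g * q h)"
proof -
  let ?n = "complex_of_real (sqrt (real CARD('g)))"
  have "(\<Sum>k\<in>UNIV. pairing q g k * q k * pairing q k h)
      = (\<Sum>k\<in>UNIV. q (k + (g + h))) / q (g + h)"
    by (simp add: sum_divide_distrib q_add[of _ "g + h"] q_nz pairing_add_right
        pairing_commute[of g] algebra_simps)
  also have "(\<Sum>k\<in>UNIV. q (k + (g + h))) = (\<Sum>k\<in>UNIV. q k)"
    by (rule sum.reindex_bij_witness[of _ "\<lambda>k. k - (g + h)" "\<lambda>k. k + (g + h)"]) auto
  finally have sum: "(\<Sum>k\<in>UNIV. pairing q g k * q k * pairing q k h) = (\<Sum>k\<in>UNIV. q k) / q (g + h)" .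
  have inv: "1 / pairing q g h = pairing q g (- h)"
    using pairing_add_right[of g h "- h"] pairing_nz[of g h] by (simp add: pairing_zero field_simps)
  have "mat_mul UNIV (mat_mul UNIV (fourier q) (diag_mat q)) (fourier q) g h
      = (1 / ?n) * (1 / ?n) * (\<Sum>k\<in>UNIV. pairing q g k * q k * pairing q k h)"
    by (subst mat_mul_diag) (simp add: mat_mul_def fourier_def sum_divide_distrib algebra_simps)
  also have "\<dots> = gauss_sum q * ((1 / ?n) * (1 / pairing q g h)) / (q g * q h)"
    by (simp add: sum gauss_sum_def q_add)
  also have "\<dots> = gauss_sum q * fourier q g (- h) / (q g * q h)"
    by (simp only: inv fourier_def)
  finally show ?thesis .
qed

text \<open>Write F for the Fourier and D for the diagonal matrix. In D F D F D the outer factors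
  cancel the denominator \<open>q g * q h\<close> of \<open>fourier_diag_fourier\<close>, leaving
  the Gauss sum times the inverse of F, which the leading F undoes.\<close>

lemma fourier_diag_cube:
  defines "A \<equiv> mat_mul UNIV (fourier q) (diag_mat q)"
  shows "mat_mul UNIV A (mat_mul UNIV A A) = mat_scale (gauss_sum q) mat_one"
proof -
  let ?D = "diag_mat q"
  have "mat_mul UNIV A (mat_mul UNIV A A)
      = mat_mul UNIV (fourier q) (mat_mul UNIV ?D (mat_mul UNIV (mat_mul UNIV A (fourier q)) ?D))"
    by (simp add: A_def mat_mul_assoc)
  also have "mat_mul UNIV ?D (mat_mul UNIV (mat_mul UNIV A (fourier q)) ?D)
      = mat_scale (gauss_sum q) (\<lambda>g h. fourier q g (- h))"
  proof (intro ext)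
    fix g h
    have "mat_mul UNIV ?D (mat_mul UNIV (mat_mul UNIV A (fourier q)) ?D) g h
        = q g * (mat_mul UNIV A (fourier q) g h * q h)"
      by (simp add: mat_mul_diag) (simp add: mat_mul_def diag_mat_def mult.assoc sum_distrib_left[symmetric])
    then show "mat_mul UNIV ?D (mat_mul UNIV (mat_mul UNIV A (fourier q)) ?D) g h
        = mat_scale (gauss_sum q) (\<lambda>g h. fourier q g (- h)) g h"
      by (simp add: A_def fourier_diag_fourier mat_scale_def q_nz)
  qed
  finally show ?thesis by (simp add: fourier_inverse)
qed

end

section \<open>The sign-odd block\<close>

text \<open>The rows are (w, 1) and (1, -w), scaled by s / sqrt 2. This is the action of
  \<open>S\<close> on the \<epsilon>-odd combinations; the entry -w is the pairing of the second
  order-two point with itself.\<close>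

definition odd_block :: "complex \<Rightarrow> complex \<Rightarrow> bool cmat"
  where "odd_block s w = (\<lambda>x y. s / complex_of_real (sqrt 2) * (if x = y then (if x then w else - w) else 1))"


lemma sum_UNIV_bool: "(\<Sum>x\<in>UNIV. f x) = f True + (f False :: complex)"
  by (simp add: UNIV_bool)

lemma sqrt2_square: "complex_of_real (sqrt 2) * complex_of_real (sqrt 2) = 2"
  by (simp flip: of_real_mult)

text \<open>The unscaled rows (w, 1), (1, -w) square to w * w + 1 = 2 times the identity, which
  cancels the squared 1 / sqrt 2 and leaves \<open>s * s\<close>.\<close>

lemma odd_block_square:
  assumes "s * s = w" and "w * w = 1"
  shows "mat_mul UNIV (odd_block s w) (odd_block s w) = diag_mat (\<lambda>_. w)"
proof (intro ext)
  fix x y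
  show "mat_mul UNIV (odd_block s w) (odd_block s w) x y = diag_mat (\<lambda>_. w) x y"
    using assms
    by (cases x; cases y) (simp_all add: mat_mul_def sum_UNIV_bool odd_block_def diag_mat_def
        mat_one_def field_simps sqrt2_square)
qed

lemma unitary_odd_block:
  assumes "norm s = 1" and "w = 1 \<or> w = -1"
  shows "unitary_mat UNIV (odd_block s w)"
proof -
  have s: "s * cnj s = 1"
    using assms(1) by (simp add: complex_norm_square[symmetric])
  show ?thesis
    unfolding unitary_mat_def mat_eq_UNIV
  proof (intro conjI ext)
    fix x y
    show "mat_mul UNIV (odd_block s w) (adjoint_mat (odd_block s w)) x y = mat_one x y"
      using assms(2) s
      by (cases x; cases y; elim disjE) (simp_all add: mat_mul_def sum_UNIV_bool odd_block_def
          adjoint_mat_def mat_one_def field_simps sqrt2_square)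
    show "mat_mul UNIV (adjoint_mat (odd_block s w)) (odd_block s w) x y = mat_one x y"
      using assms(2) s
      by (cases x; cases y; elim disjE) (simp_all add: mat_mul_def sum_UNIV_bool odd_block_def
          adjoint_mat_def mat_one_def field_simps sqrt2_square)
  qed
qed

text \<open>The first three relations give \<open>inverse t = w * t\<close> and
  \<open>inverse u = - (w * u)\<close>, so \<open>s\<close> is a multiple of \<open>t - u\<close>.
  As the squares of \<open>t\<close> and \<open>u\<close> cancel, (t - u)^2 = -2 t u, and the
  formula for \<open>c * c\<close> reduces the rest to \<open>w\<close>.\<close>

lemma odd_block_parameter:
  assumes "t * t = w" "u * u = - w" "w * w = 1" "c * c = w * t * u"
    and "s = c * ((inverse t + inverse u) / complex_of_real (sqrt 2))"
  shows "s / complex_of_real (sqrt 2) = c * w * (t - u) / 2" and "s * s = w"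
proof -
  have t: "inverse t = w * t" and u: "inverse u = - (w * u)"
    using assms(1-3) by (auto intro!: inverse_unique simp: algebra_simps)
  show p: "s / complex_of_real (sqrt 2) = c * w * (t - u) / 2"
    unfolding assms(5) t u by (simp add: field_simps sqrt2_square)
  have "(s / complex_of_real (sqrt 2)) * (s / complex_of_real (sqrt 2)) = w / 2"
  proof -
    have cancel: "t * t - 2 * (t * u) + u * u = - 2 * (t * u)"
      by (simp add: assms(1,2))
    have "(c * w * (t - u)) * (c * w * (t - u))
        = (c * c) * (w * w) * (t * t - 2 * (t * u) + u * u)"
      by (simp add: algebra_simps)
    also have "\<dots> = - 2 * w * (t * t) * (u * u)"
      unfolding cancel assms(3,4) by (simp add: ac_simps)
    also have "\<dots> = 2 * w"
      unfolding assms(1,2) by (simp add: assms(3) mult.assoc)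
    finally have "(c * w * (t - u)) * (c * w * (t - u)) = 2 * w" .
    then show ?thesis
      by (simp only: p times_divide_times_eq) simp
  qed
  then show "s * s = w" by (simp add: sqrt2_square)
qed

text \<open>\<open>A\<close> has trace x = - c t u and determinant x^2. Cayley-Hamilton then gives
  A^3 = - x^3, which equals c w by the hypotheses. The proof verifies this entry by entry.\<close>

lemma odd_block_cube:
  fixes t u :: complex
  assumes "t * t = w" "u * u = - w" "w * w = 1" "c * c = w * t * u"
    and "s = c * ((inverse t + inverse u) / complex_of_real (sqrt 2))"
  defines "A \<equiv> mat_mul UNIV (odd_block s w) (diag_mat (\<lambda>b. if b then t else u))"
  shows "mat_mul UNIV A (mat_mul UNIV A A) = mat_scale c (diag_mat (\<lambda>_. w))"
proof (intro ext)
  fix x y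
  define p where "p = c * w * (t - u) / 2"
  have A: "A = (\<lambda>x y. p * (if x = y then (if x then w else - w) else 1) * (if y then t else u))"
    unfolding A_def mat_mul_diag odd_block_def odd_block_parameter(1)[OF assms(1-5)] p_def by simp
  have p: "2 * p = c * w * (t - u)" by (simp add: p_def)
  \<comment> \<open>Every entry of the cube contains \<open>p * p * p\<close>. The identity reflects
    \<open>p * p = w / 2\<close>, a consequence of the relations between \<open>c\<close>,
    \<open>t\<close> and \<open>u\<close>.\<close>
  have "4 * (p * p * p) = c * (t - u)"
    using p assms(1-4) by algebra
  then show "mat_mul UNIV A (mat_mul UNIV A A) x y = mat_scale c (diag_mat (\<lambda>_. w)) x y"
    using assms(1-3) unfolding A mat_scale_def diag_mat_def mat_one_def mat_mul_def sum_UNIV_bool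
    by (cases x; cases y; simp) algebra+
qed

section \<open>The frame indexed by J\<close>

text \<open>The frame vector of \<open>i\<close> has the components \<open>gvec i\<close>, \<open>hvec i\<close>, \<open>ovec i\<close>: functions on \<open>G\<close> and
  \<open>\<Gamma>\<close>, and a vector in a plane carrying the \<open>\<epsilon>\<close>-odd combinations, with coordinate \<open>True\<close> for
  \<open>J\<^sub>1\<close> and \<open>False\<close> for \<open>J\<^sub>2\<close>. The minus sign at \<open>IZero\<close> is forced by the signs of the
  first two rows of \<open>S\<close>.\<close>

fun gvec :: "('g::ab_group_add, 'h) idx \<Rightarrow> 'g \<Rightarrow> complex"
  where
    "gvec IZero = mat_one 0"
  | "gvec IPi = mat_one 0"
  | "gvec (Fix1 (g, \<epsilon>)) = mat_one g"
  | "gvec (Orb1 g) = (\<lambda>k. mat_one g k + mat_one (- g) k)"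
  | "gvec (Fix2 (h, \<epsilon>)) = (\<lambda>k. 0)"
  | "gvec (Orb2 h) = (\<lambda>k. 0)"

fun hvec :: "('g, 'h::ab_group_add) idx \<Rightarrow> 'h \<Rightarrow> complex"
  where
    "hvec IZero = (\<lambda>k. - mat_one 0 k)"
  | "hvec IPi = mat_one 0"
  | "hvec (Fix1 (g, \<epsilon>)) = (\<lambda>k. 0)"
  | "hvec (Orb1 g) = (\<lambda>k. 0)"
  | "hvec (Fix2 (h, \<epsilon>)) = mat_one h"
  | "hvec (Orb2 h) = (\<lambda>k. mat_one h k + mat_one (- h) k)"

fun ovec :: "('g, 'h) idx \<Rightarrow> bool \<Rightarrow> complex"
  where
    "ovec IZero = (\<lambda>k. 0)"
  | "ovec IPi = (\<lambda>k. 0)"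
  | "ovec (Fix1 (g, \<epsilon>)) = (\<lambda>k. \<epsilon> * mat_one True k)"
  | "ovec (Orb1 g) = (\<lambda>k. 0)"
  | "ovec (Fix2 (h, \<epsilon>)) = (\<lambda>k. \<epsilon> * mat_one False k)"
  | "ovec (Orb2 h) = (\<lambda>k. 0)"

definition frame_vec :: "('g::ab_group_add, 'h::ab_group_add) idx \<Rightarrow> ('g + 'h) + bool \<Rightarrow> complex"
  where "frame_vec i = case_sum (case_sum (gvec i) (hvec i)) (ovec i)"

definition reflect :: "('g::ab_group_add + 'h::ab_group_add) + bool \<Rightarrow> ('g + 'h) + bool"
  where "reflect = map_sum (map_sum uminus uminus) id"

lemma frame_vec_simps [simp]:
  "frame_vec i (Inl (Inl g)) = gvec i g"
  "frame_vec i (Inl (Inr h)) = hvec i h"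
  "frame_vec i (Inr x) = ovec i x"
  by (simp_all add: frame_vec_def)

lemma reflect_simps [simp]:
  "reflect (Inl (Inl g)) = Inl (Inl (- g))"
  "reflect (Inl (Inr h)) = Inl (Inr (- h))"
  "reflect (Inr x) = Inr x"
  by (simp_all add: reflect_def)

lemma bilin_scale_vec [simp]:
  "bilin A (\<lambda>k. e * u k) v = e * bilin A u v"
  "bilin A u (\<lambda>k. e * v k) = e * bilin A u v"
  by (simp_all add: bilin_def sum_distrib_left algebra_simps)

lemma bilin_block_diag:
  fixes A :: "'g::{ab_group_add,finite} cmat" and B :: "'h::{ab_group_add,finite} cmat"
  shows "bilin (block_diag A B M) (frame_vec i) (frame_vec j) =
    bilin A (gvec i) (gvec j) + bilin B (hvec i) (hvec j) + bilin M (ovec i) (ovec j)"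
  by (simp add: bilin_def sum_UNIV_sum)

section \<open>Sums over J and over half systems\<close>

lemma sum_index_set:
  assumes "finite Gs" "finite Hs"
  shows "(\<Sum>j\<in>index_set g\<^sub>0 h\<^sub>0 Gs Hs. f j) =
    f IZero + f IPi + (f (Fix1 (g\<^sub>0, 1)) + f (Fix1 (g\<^sub>0, -1))) + (\<Sum>g\<in>Gs. f (Orb1 g))
      + (f (Fix2 (h\<^sub>0, 1)) + f (Fix2 (h\<^sub>0, -1))) + (\<Sum>h\<in>Hs. f (Orb2 h) :: complex)"
proof -
  have orb: "(\<Sum>g\<in>Gs. f (Orb1 g)) = sum f (Orb1 ` Gs)" "(\<Sum>h\<in>Hs. f (Orb2 h)) = sum f (Orb2 ` Hs)"
    by (simp_all add: sum.reindex inj_on_def)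
  have eps: "f (Fix1 (g\<^sub>0, 1)) + f (Fix1 (g\<^sub>0, -1)) = sum f (Fix1 ` ({g\<^sub>0} \<times> {1, -1}))"
    "f (Fix2 (h\<^sub>0, 1)) + f (Fix2 (h\<^sub>0, -1)) = sum f (Fix2 ` ({h\<^sub>0} \<times> {1, -1}))"
    by simp_all
  have zero: "f IZero + f IPi = sum f {IZero, IPi}" by simp
  have "finite ({g\<^sub>0} \<times> {1, -1::complex})" "finite ({h\<^sub>0} \<times> {1, -1::complex})"
    by simp_all
  then show ?thesis
    unfolding orb eps zero index_set_def
    by ((subst sum.union_disjoint; (auto simp: assms; fail)?)+)
qed

text \<open>The factors 2 stand for the two indices \<open>IZero\<close>, \<open>IPi\<close> over 0
  and the two signs over \<open>g\<^sub>0\<close>. At a torsion point \<open>- g = g\<close>, so the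
  right side doubles as well; elsewhere exactly one of \<open>g\<close>, \<open>- g\<close> lies in
  \<open>H\<close> and selects one summand.\<close>

lemma half_system_sum:
  fixes g g' :: "'g::{ab_group_add,finite}"
  assumes tors: "(two_torsion :: 'g set) = {0, g\<^sub>0}" and "g\<^sub>0 \<noteq> 0" and H: "half_system H"
  shows "2 * (mat_one 0 g * mat_one 0 g') + 2 * (mat_one g\<^sub>0 g * mat_one g\<^sub>0 g')
      + (\<Sum>h\<in>H. (mat_one h g + mat_one (- h) g) * (mat_one h g' + mat_one (- h) g'))
    = mat_one g g' + mat_one (- g) g'"
proof -
  let ?f = "\<lambda>h. (mat_one h g + mat_one (- h) g) * (mat_one h g' + mat_one (- h) g')"
  have disj: "two_torsion \<inter> H = {}" "two_torsion \<inter> uminus ` H = {}" "H \<inter> uminus ` H = {}"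
    and cover: "g \<in> two_torsion \<or> g \<in> H \<or> g \<in> uminus ` H"
    using H by (auto simp: half_system_def)
  consider "g \<in> two_torsion" | "g \<notin> two_torsion" "g \<in> H" | "g \<notin> two_torsion" "- g \<in> H"
    using cover by fastforce
  then show ?thesis
  proof cases
    case 1
    then have "g + g = 0" by (simp add: two_torsion_def)
    then have "- g = g" by (simp add: minus_unique)
    moreover have "(\<Sum>h\<in>H. ?f h) = 0"
      using 1 disj(1,2) by (intro sum.neutral) (auto simp: mat_one_def)
    ultimately show ?thesis
      using 1 \<open>g\<^sub>0 \<noteq> 0\<close> by (auto simp: tors mat_one_def)
  next
    case 2
    then have "- g \<noteq> g"
      by (metis IntI disj(3) empty_iff imageI)
    have "(\<Sum>h\<in>H. ?f h) = (\<Sum>h\<in>H. if g = h then mat_one h g' + mat_one (- h) g' else 0)"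
      using 2 disj(3) \<open>- g \<noteq> g\<close> by (intro sum.cong) (auto simp: mat_one_def)
    then show ?thesis
      using 2 \<open>- g \<noteq> g\<close> by (auto simp: tors mat_one_def)
  next
    case 3
    then have "- g \<noteq> g"
      by (metis IntI disj(3) empty_iff imageI minus_minus)
    have "(\<Sum>h\<in>H. ?f h) = (\<Sum>h\<in>H. if - g = h then mat_one h g' + mat_one (- h) g' else 0)"
      using 3 disj(3) \<open>- g \<noteq> g\<close> by (intro sum.cong) (auto simp: mat_one_def)
    then show ?thesis
      using 3 \<open>- g \<noteq> g\<close> by (auto simp: tors mat_one_def)
  qed
qed

lemma half_system_neq:
  "half_system H \<Longrightarrow> g \<in> H \<Longrightarrow> h \<in> H \<Longrightarrow> g \<noteq> - h"
  by (auto simp: half_system_def)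

lemma half_system_torsion:
  "half_system H \<Longrightarrow> two_torsion = {0, g\<^sub>0} \<Longrightarrow> g \<in> H \<Longrightarrow> g \<noteq> 0 \<and> g \<noteq> g\<^sub>0 \<and> g\<^sub>0 \<noteq> g \<and> - g \<noteq> g\<^sub>0 \<and> g\<^sub>0 \<noteq> - g"
  unfolding half_system_def by blast

lemma index_cases [consumes 1, case_names IZero IPi Fix1 Orb1 Fix2 Orb2]:
  assumes "i \<in> index_set g\<^sub>0 h\<^sub>0 Gs Hs"
  obtains "i = IZero" | "i = IPi"
    | e where "i = Fix1 (g\<^sub>0, e)" "e = 1 \<or> e = -1" | g where "i = Orb1 g" "g \<in> Gs"
    | e where "i = Fix2 (h\<^sub>0, e)" "e = 1 \<or> e = -1" | h where "i = Orb2 h" "h \<in> Hs"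
  using assms unfolding index_set_def by auto

section \<open>The frame property and the matrices read off in the frame\<close>

locale index_system =
  fixes g\<^sub>0 :: "'g::{ab_group_add,finite}" and h\<^sub>0 :: "'h::{ab_group_add,finite}"
    and Gs :: "'g set" and Hs :: "'h set"
  assumes torsion1: "(two_torsion :: 'g set) = {0, g\<^sub>0}" and g\<^sub>0: "g\<^sub>0 \<noteq> 0"
    and torsion2: "(two_torsion :: 'h set) = {0, h\<^sub>0}" and h\<^sub>0: "h\<^sub>0 \<noteq> 0"
    and half1: "half_system Gs" and half2: "half_system Hs"
begin

abbreviation J where "J \<equiv> index_set g\<^sub>0 h\<^sub>0 Gs Hs"

lemma finite_J: "finite J"
  unfolding index_set_def by (intro finite_UnI finite_imageI finite_cartesian_product) auto

lemma minus_g0: "- g\<^sub>0 = g\<^sub>0" and minus_h0: "- h\<^sub>0 = h\<^sub>0"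
  using torsion1 torsion2 by (auto simp: two_torsion_def intro!: minus_unique)

lemma frame_vec_sum:
  "(\<Sum>j\<in>J. frame_vec j k * frame_vec j l) = mat_one k l + mat_one (reflect k) l"
proof -
  have torsion: "(\<Sum>j\<in>J. gvec j g * gvec j g') = mat_one g g' + mat_one (- g) g'"
    "(\<Sum>j\<in>J. hvec j h * hvec j h') = mat_one h h' + mat_one (- h) h'" for g g' h h'
    using half_system_sum[OF torsion1 g\<^sub>0 half1, of g g'] half_system_sum[OF torsion2 h\<^sub>0 half2, of h h']
    by (simp_all add: sum_index_set ac_simps)
  \<comment> \<open>The mixed terms cancel in pairs: \<open>IZero\<close> against \<open>IPi\<close>
    by the minus sign in \<open>hvec IZero\<close>, and \<epsilon> = 1 against \<epsilon> =
    -1.\<close>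
  have "(\<Sum>j\<in>J. gvec j g * hvec j h) = 0" "(\<Sum>j\<in>J. gvec j g * ovec j x) = 0"
    "(\<Sum>j\<in>J. hvec j h * ovec j x) = 0" "(\<Sum>j\<in>J. hvec j h * gvec j g) = 0"
    "(\<Sum>j\<in>J. ovec j x * gvec j g) = 0" "(\<Sum>j\<in>J. ovec j x * hvec j h) = 0" for g h x
    by (simp_all add: sum_index_set)
  \<comment> \<open>The 2 matches both terms of the frame identity, since \<open>reflect\<close>
    fixes the plane pointwise.\<close>
  moreover have "(\<Sum>j\<in>J. ovec j x * ovec j y) = 2 * mat_one x y" for x y
    by (cases x; cases y) (simp_all add: sum_index_set mat_one_def)
  ultimately show ?thesis
    using torsion by (cases k rule: block_index_cases; cases l rule: block_index_cases) simp_all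
qed

lemma frame_vec_reflect:
  assumes "j \<in> J"
  shows "frame_vec j (reflect k) = frame_vec j k"
proof -
  have minus: "g\<^sub>0 = - g \<longleftrightarrow> g\<^sub>0 = g" "h\<^sub>0 = - h \<longleftrightarrow> h\<^sub>0 = h" for g h
    using minus_g0 minus_h0 by (metis minus_minus)+
  have "gvec j (- g) = gvec j g" for g
    using assms by (cases rule: index_cases) (auto simp: mat_one_def minus)
  moreover have "hvec j (- h) = hvec j h" for h
    using assms by (cases rule: index_cases) (auto simp: mat_one_def minus)
  ultimately show ?thesis
    unfolding reflect_def frame_vec_def by (simp split: sum.split)
qed

lemma frame_vec_real: "j \<in> J \<Longrightarrow> cnj (frame_vec j k) = frame_vec j k"
  by (cases rule: index_cases) (auto simp: frame_vec_def mat_one_def split: sum.split)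

text \<open>For \<open>w = 1\<close> this computes \<open>T\<close> and the identity, for constant \<open>x\<close> and \<open>y\<close> it computes \<open>C\<close>.\<close>

lemma bilin_frame_diag:
  assumes x: "x 0 = 1" "\<And>g. x (- g) = x g" and y: "y 0 = 1" "\<And>h. y (- h) = y h"
    and w: "w = 1 \<or> w = -1"
  shows "mat_eq J
    (\<lambda>i j. bilin (block_diag (diag_mat x) (diag_mat y)
        (diag_mat (\<lambda>b. w * (if b then x g\<^sub>0 else y h\<^sub>0)))) (frame_vec i) (frame_vec j) / 2)
    (\<lambda>i j. if idx_bar w i = j then T_entry x y i else 0)"
  unfolding mat_eq_def bilin_block_diag
proof (intro ballI)
  fix i j
  assume "i \<in> J" "j \<in> J"
  note neq = half_system_neq[OF half1] half_system_neq[OF half2]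
    half_system_torsion[OF half1 torsion1] half_system_torsion[OF half2 torsion2]
  show "(bilin (diag_mat x) (gvec i) (gvec j) + bilin (diag_mat y) (hvec i) (hvec j)
      + bilin (diag_mat (\<lambda>b. w * (if b then x g\<^sub>0 else y h\<^sub>0))) (ovec i) (ovec j)) / 2
    = (if idx_bar w i = j then T_entry x y i else 0)"
    using \<open>i \<in> J\<close>
  proof (cases rule: index_cases)
    \<comment> \<open>Against \<open>IZero\<close> the value is (x 0 + y 0) / 2 and against
      \<open>IPi\<close> it is (x 0 - y 0) / 2, so the normalisation yields 1 and 0.\<close>
    case IZero
    with \<open>j \<in> J\<close> show ?thesis
      by (cases rule: index_cases) (use g\<^sub>0 h\<^sub>0 neq x y in \<open>auto simp: diag_mat_apply\<close>)
  next
    case IPi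
    with \<open>j \<in> J\<close> show ?thesis
      by (cases rule: index_cases) (use g\<^sub>0 h\<^sub>0 neq x y in \<open>auto simp: diag_mat_apply\<close>)
  next
    \<comment> \<open>For signs e and e' the value is x(g0) (1 + w e e') / 2, which is x(g0) when e'
      = w e and 0 otherwise. This is the sign change made by \<open>idx_bar w\<close>.\<close>
    case Fix1
    with \<open>j \<in> J\<close> show ?thesis
      by (cases rule: index_cases) (use g\<^sub>0 h\<^sub>0 neq x y w in \<open>auto simp: diag_mat_apply\<close>)
  next
    case Orb1
    with \<open>j \<in> J\<close> show ?thesis
      by (cases rule: index_cases) (use g\<^sub>0 h\<^sub>0 neq x y in \<open>auto simp: diag_mat_apply\<close>)
  next
    case Fix2
    with \<open>j \<in> J\<close> show ?thesis
      by (cases rule: index_cases) (use g\<^sub>0 h\<^sub>0 neq x y w in \<open>auto simp: diag_mat_apply\<close>)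
  next
    case Orb2
    with \<open>j \<in> J\<close> show ?thesis
      by (cases rule: index_cases) (use g\<^sub>0 h\<^sub>0 neq x y in \<open>auto simp: diag_mat_apply\<close>)
  qed
qed

sublocale invariant_frame J frame_vec reflect
proof
  show "(\<Sum>j\<in>J. frame_vec j k * frame_vec j l) = mat_one k l + mat_one (reflect k) l" for k l
    by (rule frame_vec_sum)
  show "reflect (reflect k) = k" for k :: "('g + 'h) + bool"
    by (auto simp: reflect_def sum.map_comp o_def id_def sum.map_ident)
  show "mat_eq J (\<lambda>i j. bilin mat_one (frame_vec i) (frame_vec j) / 2) mat_one"
  proof -
    have "idx_bar 1 i = i" "T_entry (\<lambda>_. 1) (\<lambda>_. 1) i = 1" for i :: "('g, 'h) idx"
      by (cases i; auto)+
    then show ?thesis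
      \<comment> \<open>With all data equal to 1 the diagonal formula is the orthonormality of the
        frame.\<close>
      using bilin_frame_diag[of "\<lambda>_. 1" "\<lambda>_. 1" 1]
      by (simp add: diag_mat_one block_diag_one mat_one_def[symmetric] cong: if_cong)
  qed
qed (simp_all add: frame_vec_reflect frame_vec_real)

lemma equivariant_block_diag:
  assumes "\<And>g g'. A (- g) g' = A g (- g')" "\<And>h h'. B (- h) h' = B h (- h')"
  shows "equivariant (block_diag A B M)"
  unfolding equivariant_def
proof (intro allI)
  fix k l
  show "block_diag A B M (reflect k) l = block_diag A B M k (reflect l)"
    using assms by (auto simp: block_diag_def reflect_def split: sum.split)
qed

lemma equivariant_block_diag_diag:
  assumes "\<And>g. x (- g) = x g" "\<And>h. y (- h) = y h"
  shows "equivariant (block_diag (diag_mat x) (diag_mat y) M)"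
  by (rule equivariant_block_diag) (use assms in \<open>auto simp: diag_mat_def mat_one_def\<close>)

text \<open>Expanding the frame vectors into \<open>mat_one\<close> gives every block: orbit vectors
  produce a character plus its conjugate, and the terms with \<epsilon> \<epsilon>' come from the
  plane.\<close>

lemma S_blocks_compress:
  assumes q\<^sub>1: "metric_group q\<^sub>1" and q\<^sub>2: "metric_group q\<^sub>2"
    and w: "pairing q\<^sub>1 g\<^sub>0 g\<^sub>0 = w" "pairing q\<^sub>2 h\<^sub>0 h\<^sub>0 = - w"
  shows "mat_eq J
    (S_blocks (1 / complex_of_real (sqrt (real CARD('g)))) (1 / complex_of_real (sqrt (real CARD('h))))
      s (2 * complex_of_real (sqrt 2)) (pairing q\<^sub>1) (pairing q\<^sub>2))
    (compress (block_diag (fourier q\<^sub>1) (mat_scale (-1) (fourier q\<^sub>2)) (odd_block s w)))"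
  unfolding mat_eq_def compress_def bilin_block_diag bilin_scale_mat
proof (intro ballI)
  fix i j
  assume "i \<in> J" "j \<in> J"
  \<comment> \<open>An orbit vector meets an order-two point in the pairing plus its conjugate;
    realness makes this twice the pairing, and the division by 2 leaves the entry of
    \<open>S\<close>.\<close>
  have real: "cnj (pairing q\<^sub>1 g\<^sub>0 g) = pairing q\<^sub>1 g\<^sub>0 g" "cnj (pairing q\<^sub>2 h\<^sub>0 h) = pairing q\<^sub>2 h\<^sub>0 h"
    "cnj (pairing q\<^sub>1 g g\<^sub>0) = pairing q\<^sub>1 g g\<^sub>0" "cnj (pairing q\<^sub>2 h h\<^sub>0) = pairing q\<^sub>2 h h\<^sub>0" for g h
    using pairing_minus[OF q\<^sub>1] pairing_minus[OF q\<^sub>2] minus_g0 minus_h0 by metis+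
  note facts = real w pairing_zero[OF q\<^sub>1] pairing_zero[OF q\<^sub>2]
    pairing_minus[OF q\<^sub>1] pairing_minus[OF q\<^sub>2]
  show "S_blocks (1 / complex_of_real (sqrt (real CARD('g)))) (1 / complex_of_real (sqrt (real CARD('h))))
      s (2 * complex_of_real (sqrt 2)) (pairing q\<^sub>1) (pairing q\<^sub>2) i j
    = (bilin (fourier q\<^sub>1) (gvec i) (gvec j) + -1 * bilin (fourier q\<^sub>2) (hvec i) (hvec j)
      + bilin (odd_block s w) (ovec i) (ovec j)) / 2"
    using \<open>i \<in> J\<close>
    by (cases rule: index_cases; use \<open>j \<in> J\<close> in \<open>cases rule: index_cases\<close>)
      (simp_all add: facts fourier_def odd_block_def field_simps)
qed

end

section \<open>Transfer of the relations to J\<close>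

theorem lemma4p2:
  fixes q\<^sub>1 :: "'g::{ab_group_add,finite} \<Rightarrow> complex"
    and q\<^sub>2 :: "'h::{ab_group_add,finite} \<Rightarrow> complex"
    and g\<^sub>0 :: 'g and \<gamma>\<^sub>0 :: 'h
    and Gs :: "'g set" and \<Gamma>s :: "'h set"
    and c :: complex
    and J :: "('g, 'h) idx set" and S T C :: "('g, 'h) idx cmat"
  assumes "metric_group q\<^sub>1" and "metric_group q\<^sub>2"
    and "(two_torsion :: 'g set) = {0, g\<^sub>0}" and "g\<^sub>0 \<noteq> 0"
    and "(two_torsion :: 'h set) = {0, \<gamma>\<^sub>0}" and "\<gamma>\<^sub>0 \<noteq> 0"
    and "c = gauss_sum q\<^sub>1" and "c = - gauss_sum q\<^sub>2"
    and "pairing q\<^sub>1 g\<^sub>0 g\<^sub>0 = - pairing q\<^sub>2 \<gamma>\<^sub>0 \<gamma>\<^sub>0"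
    and "c ^ 2 = inverse (q\<^sub>1 g\<^sub>0) * q\<^sub>2 \<gamma>\<^sub>0"
    and "half_system Gs" and "half_system \<Gamma>s"
    and "J = index_set g\<^sub>0 \<gamma>\<^sub>0 Gs \<Gamma>s"
    and "S = S_mat c q\<^sub>1 q\<^sub>2 g\<^sub>0 \<gamma>\<^sub>0"
    and "T = T_mat q\<^sub>1 q\<^sub>2"
    and "C = C_mat q\<^sub>1 g\<^sub>0"
  shows "unitary_mat J S \<and> unitary_mat J T \<and> unitary_mat J C
    \<and> mat_eq J (mat_mul J S S) C
    \<and> mat_eq J (mat_pow J (mat_mul J S T) 3) (mat_scale c C)
    \<and> mat_eq J (mat_mul J T C) (mat_mul J C T)"
proof -
  interpret index_system g\<^sub>0 \<gamma>\<^sub>0 Gs \<Gamma>s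
    using assms by unfold_locales
  note q\<^sub>1 = \<open>metric_group q\<^sub>1\<close> and q\<^sub>2 = \<open>metric_group q\<^sub>2\<close> and J = assms(13)
  define w where "w = pairing q\<^sub>1 g\<^sub>0 g\<^sub>0"
  define t where "t = q\<^sub>1 g\<^sub>0"
  define u where "u = q\<^sub>2 \<gamma>\<^sub>0"
  define s where "s = c * ((inverse t + inverse u) / complex_of_real (sqrt 2))"
  have torsion: "g\<^sub>0 + g\<^sub>0 = 0" "\<gamma>\<^sub>0 + \<gamma>\<^sub>0 = 0"
    using assms(3,5) by (auto simp: two_torsion_def)
  have nz: "t \<noteq> 0" "u \<noteq> 0"
    by (simp_all add: t_def u_def q_nz q\<^sub>1 q\<^sub>2)
  have "w * w = 1"
    using pairing_add_left[OF q\<^sub>1, of g\<^sub>0 g\<^sub>0 g\<^sub>0] by (simp add: torsion pairing_zero q\<^sub>1 w_def)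
  then have w: "w = 1 \<or> w = -1"
    by (simp add: square_eq_1_iff)
  then have "norm w = 1"
    by auto
  have w\<^sub>2: "pairing q\<^sub>2 \<gamma>\<^sub>0 \<gamma>\<^sub>0 = - w"
    using assms(9) by (simp add: w_def)
  \<comment> \<open>At a point x of order two, q(x + x) = 1 reads q(x)^2 <x, x> = 1, and here <x, x>
    is 1 or -1, hence its own inverse.\<close>
  have t: "t * t = w" and u: "u * u = - w"
  proof -
    have "t * t * w = 1" "u * u * (- w) = 1"
      using q_add[OF q\<^sub>1, of g\<^sub>0 g\<^sub>0] q_add[OF q\<^sub>2, of \<gamma>\<^sub>0 \<gamma>\<^sub>0]
      by (simp_all add: torsion q_zero q\<^sub>1 q\<^sub>2 w\<^sub>2 t_def u_def flip: w_def)
    then show "t * t = w" "u * u = - w"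
      using w by (auto simp: minus_equation_iff)
  qed
  have inv_t: "inverse t = w * t"
    using t \<open>w * w = 1\<close> by (metis inverse_unique mult.assoc mult.commute)
  then have c: "c * c = w * t * u"
    using assms(10) by (simp add: power2_eq_square t_def u_def)
  note parameters = t u \<open>w * w = 1\<close> c s_def
  have "s * s = w"
    by (rule odd_block_parameter(2)[OF parameters])
  then have "norm s * norm s = 1"
    using w by (auto simp flip: norm_mult)
  then have "norm s = 1"
    using norm_ge_zero[of s] by (simp add: square_eq_1_iff)

  \<comment> \<open>Lifts of \<open>S\<close>, \<open>T\<close> and \<open>C\<close>. The involution
    of \<open>J\<close> moves only the signs \<epsilon>, so \<open>D\<^sub>C\<close> is the identity
    on both function spaces and \<open>w\<close> on the plane.\<close>
  define D\<^sub>S where "D\<^sub>S = block_diag (fourier q\<^sub>1) (mat_scale (-1) (fourier q\<^sub>2)) (odd_block s w)"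
  define D\<^sub>T where "D\<^sub>T = block_diag (diag_mat q\<^sub>1) (diag_mat q\<^sub>2) (diag_mat (\<lambda>b. if b then t else u))"
  define D\<^sub>C :: "(('g + 'h) + bool) cmat"
    where "D\<^sub>C = block_diag (diag_mat (\<lambda>_. 1)) (diag_mat (\<lambda>_. 1)) (diag_mat (\<lambda>_. w))"
  have S: "mat_eq J S (compress D\<^sub>S)"
    using S_blocks_compress[OF q\<^sub>1 q\<^sub>2 w_def[symmetric] w\<^sub>2, of s]
    by (simp add: assms(14) S_mat_def Let_def J D\<^sub>S_def s_def t_def u_def)
  have T: "mat_eq J T (compress D\<^sub>T)"
  proof -
    have "idx_bar 1 i = i" for i :: "('g, 'h) idx"
      by (cases i) auto
    then have "mat_eq J (compress D\<^sub>T) T"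
      using bilin_frame_diag[of q\<^sub>1 q\<^sub>2 1]
      by (simp add: assms(15) T_mat_def J compress_def D\<^sub>T_def t_def u_def
          q_zero q_minus q\<^sub>1 q\<^sub>2 cong: if_cong)
    then show ?thesis by (rule mat_eq_sym)
  qed
  have C: "mat_eq J C (compress D\<^sub>C)"
  proof -
    have "T_entry (\<lambda>_. 1) (\<lambda>_. 1) i = 1" for i :: "('g, 'h) idx"
      by (cases i) auto
    then have "mat_eq J (compress D\<^sub>C) C"
      using bilin_frame_diag[of "\<lambda>_. 1" "\<lambda>_. 1" w] w
      by (simp add: assms(16) C_mat_def J compress_def D\<^sub>C_def flip: w_def cong: if_cong)
    then show ?thesis by (rule mat_eq_sym)
  qed
  have equiv_S: "equivariant D\<^sub>S"
    unfolding D\<^sub>S_def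
    by (intro equivariant_block_diag) (simp_all add: mat_scale_def fourier_minus q\<^sub>1 q\<^sub>2)
  have equiv_T: "equivariant D\<^sub>T" and equiv_C: "equivariant D\<^sub>C"
    unfolding D\<^sub>T_def D\<^sub>C_def by (intro equivariant_block_diag_diag; simp add: q_minus q\<^sub>1 q\<^sub>2)+

  have "unitary_mat UNIV (mat_scale (-1) (fourier q\<^sub>2))"
    using unitary_fourier[OF q\<^sub>2]
    by (simp add: unitary_mat_def mat_eq_def adjoint_mat_def mat_mul_def mat_scale_def)
  then have "unitary_mat J S"
    using unitary_compress[OF _ equiv_S] unitary_mat_cong[OF S] \<open>norm s = 1\<close> w
    by (simp add: D\<^sub>S_def J unitary_block_diag unitary_fourier q\<^sub>1 unitary_odd_block)
  moreover have "unitary_mat J T"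
    using unitary_compress[OF _ equiv_T] unitary_mat_cong[OF T]
    by (simp add: D\<^sub>T_def J unitary_block_diag unitary_diag q_norm q\<^sub>1 q\<^sub>2 t_def u_def)
  moreover have "unitary_mat J C"
    using unitary_compress[OF _ equiv_C] unitary_mat_cong[OF C] \<open>norm w = 1\<close>
    by (simp add: D\<^sub>C_def J unitary_block_diag unitary_diag)
  moreover have "mat_eq J (mat_mul J S S) C"
  proof -
    have "mat_eq J (mat_mul J S S) (compress (mat_mul UNIV D\<^sub>S D\<^sub>S))"
      using mat_eq_trans[OF mat_eq_mul[OF S S]] compress_mul[OF equiv_S] by (simp add: J)
    \<comment> \<open>The Fourier blocks square to reflections, so the square of
      \<open>D\<^sub>S\<close> is matched with \<open>D\<^sub>C\<close> only up to
      \<open>reflect\<close>, which compression does not see.\<close>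
    moreover have "mat_eq J (compress (mat_mul UNIV D\<^sub>S D\<^sub>S)) (compress D\<^sub>C)"
      unfolding J
    proof (rule compress_reflect)
      fix k l
      have "mat_mul UNIV D\<^sub>S D\<^sub>S
          = block_diag (\<lambda>g h. mat_one g (- h)) (\<lambda>g h. mat_one g (- h)) (diag_mat (\<lambda>_. w))"
        using odd_block_square[OF \<open>s * s = w\<close> \<open>w * w = 1\<close>]
        by (simp add: D\<^sub>S_def mat_mul_block_diag fourier_square q\<^sub>1 q\<^sub>2)
      then show "mat_mul UNIV D\<^sub>S D\<^sub>S k l = D\<^sub>C k (reflect l)"
        by (auto simp: D\<^sub>C_def diag_mat_one block_diag_def reflect_def split: sum.split)
    qed
    ultimately show ?thesis
      using mat_eq_trans mat_eq_sym[OF C] by blast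
  qed
  moreover have "mat_eq J (mat_pow J (mat_mul J S T) 3) (mat_scale c C)"
  proof -
    define A where "A = mat_mul UNIV D\<^sub>S D\<^sub>T"
    have equiv_A: "equivariant A"
      unfolding A_def using equiv_S equiv_T by (rule equivariant_mul)
    have A: "mat_eq J (mat_mul J S T) (compress A)"
      using mat_eq_trans[OF mat_eq_mul[OF S T]] compress_mul[OF equiv_T] by (simp add: J A_def)
    have "mat_eq J (mat_mul J (mat_mul J S T) (mat_mul J S T)) (compress (mat_mul UNIV A A))"
      using mat_eq_trans[OF mat_eq_mul[OF A A]] compress_mul[OF equiv_A] by (simp add: J)
    from mat_eq_mul[OF A this]
    have "mat_eq J (mat_mul J (mat_mul J S T) (mat_mul J (mat_mul J S T) (mat_mul J S T)))
        (compress (mat_mul UNIV A (mat_mul UNIV A A)))"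
      using mat_eq_trans compress_mul[OF equivariant_mul[OF equiv_A equiv_A]] unfolding J by blast
    \<comment> \<open>On \<Gamma> the cube of the factor -1 turns \<open>gauss_sum q\<^sub>2\<close>
      into \<open>c\<close>, in agreement with the value on G; the plane contributes
      \<open>c * w\<close>.\<close>
    moreover have "mat_mul UNIV A (mat_mul UNIV A A) = mat_scale c D\<^sub>C"
      using fourier_diag_cube[OF q\<^sub>1] fourier_diag_cube[OF q\<^sub>2] odd_block_cube[OF parameters]
        assms(7,8)
      by (simp add: A_def D\<^sub>S_def D\<^sub>T_def D\<^sub>C_def mat_mul_block_diag mat_scale_block_diag diag_mat_one)
    ultimately have "mat_eq J (mat_mul J (mat_mul J S T) (mat_mul J (mat_mul J S T) (mat_mul J S T)))
        (mat_scale c C)"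
      using mat_eq_trans mat_eq_scale[OF mat_eq_sym[OF C]] by (metis compress_scale)
    then show ?thesis
      using mat_eq_trans[OF mat_pow_3] finite_J J by blast
  qed
  moreover have "mat_eq J (mat_mul J T C) (mat_mul J C T)"
  proof -
    have "mat_mul UNIV D\<^sub>T D\<^sub>C = mat_mul UNIV D\<^sub>C D\<^sub>T"
      by (simp add: D\<^sub>T_def D\<^sub>C_def mat_mul_block_diag diag_mul_diag mult.commute)
    moreover have "mat_eq J (mat_mul J T C) (compress (mat_mul UNIV D\<^sub>T D\<^sub>C))"
      using mat_eq_trans[OF mat_eq_mul[OF T C]] compress_mul[OF equiv_C] by (simp add: J)
    moreover have "mat_eq J (mat_mul J C T) (compress (mat_mul UNIV D\<^sub>C D\<^sub>T))"
      using mat_eq_trans[OF mat_eq_mul[OF C T]] compress_mul[OF equiv_T] by (simp add: J)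
    ultimately show ?thesis
      using mat_eq_trans mat_eq_sym by metis
  qed
  ultimately show ?thesis by blast
qed

end
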